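(* Let $D\subset\mathbb{R}^d$ be a bounded Lipschitz domain. Then the following kernels are asymptotically smooth on $D$: (i) the polyharmonic splines, i.e., for every positive integer $\ell$, $\mathcal{K}(\boldsymbol{x},\boldsymbol{y})=\|\boldsymbol{x}-\boldsymbol{y}\|_2^\ell$ if $\ell$ is odd and $\mathcal{K}(\boldsymbol{x},\boldsymbol{y})=\|\boldsymbol{x}-\boldsymbol{y}\|_2^\ell\log\|\boldsymbol{x}-\boldsymbol{y}\|_2$ if $\ell$ is even; (ii) the multiquadrics, i.e., for all $c,\beta>0$ with $\beta\notin\mathbb{N}$, $\mathcal{K}(\boldsymbol{x},\boldsymbol{y})=(-1)^{\lceil\beta\rceil}(c^2+\|\boldsymbol{x}-\boldsymbol{y}\|_2^2)^\beta$.
   Context: A kernel $\mathcal{K}\colon D\times D\to\mathbb{R}$ is called asymptotically smooth if there exist constants $C,r>0$ such that for all multi-indices $\boldsymbol{\alpha},\boldsymbol{\beta}\in\mathbb{N}_0^d$ and all $\boldsymbol{x},\boldsymbol{z}\in D$ with $\boldsymbol{x}\ne\boldsymbol{z}$, $$\bigg|\frac{\partial^{|\boldsymbol{\alpha}|+|\boldsymbol{\beta}|}}{\partial\boldsymbol{x}^{\boldsymbol{\alpha}}\partial\boldsymbol{z}^{\boldsymbol{\beta}}}\mathcal{K}(\boldsymbol{x},\boldsymbol{z})\bigg|\le C\,\frac{(|\boldsymbol{\alpha}|+|\boldsymbol{\beta}|)!}{r^{|\boldsymbol{\alpha}|+|\boldsymbol{\beta}|}\,\|\boldsymbol{x}-\boldsymbol{z}\|_2^{|\boldsymbol{\alpha}|+|\boldsymbol{\beta}|}}.$$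 The constants $C,r$ may depend on the kernel and on $D$ but not on $\boldsymbol{\alpha},\boldsymbol{\beta},\boldsymbol{x},\boldsymbol{z}$. *)

theory Defs
  imports "HOL-Analysis.Analysis"
begin

text \<open>
  A Lipschitz domain is a nonempty, open, connected set that locally, in suitable orthonormal
  coordinates, lies strictly above the graph of a Lipschitz function. The unit vector \<open>e\<close> is the
  vertical direction of those coordinates; the function \<open>g\<close> only matters on the hyperplane
  orthogonal to \<open>e\<close>.
\<close>

definition lipschitz_domain :: "'a::euclidean_space set \<Rightarrow> bool" where
  "lipschitz_domain D \<longleftrightarrow>
     D \<noteq> {} \<and> open D \<and> connected D \<and>
     (\<forall>p\<in>frontier D. \<exists>U e g L.
        open U \<and> p \<in> U \<and> norm e = 1 \<and> L-lipschitz_on {y. y \<bullet> e = 0} (g :: 'a \<Rightarrow> real) \<and>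
        D \<inter> U = {x\<in>U. g (x - (x \<bullet> e) *\<^sub>R e) < x \<bullet> e} \<and>
        frontier D \<inter> U = {x\<in>U. g (x - (x \<bullet> e) *\<^sub>R e) = x \<bullet> e})"

definition partial_deriv :: "'a::euclidean_space \<Rightarrow> ('a \<Rightarrow> real) \<Rightarrow> 'a \<Rightarrow> real" where
  "partial_deriv b f x = deriv (\<lambda>t. f (x + t *\<^sub>R b)) 0"

definition iterated_partial_deriv :: "'a::euclidean_space list \<Rightarrow> ('a \<Rightarrow> real) \<Rightarrow> 'a \<Rightarrow> real" where
  "iterated_partial_deriv bs f = foldr partial_deriv bs f"

text \<open>
  For open \<open>S\<close> this is the class of infinitely differentiable functions. It makes the total function
  \<^const>\<open>deriv\<close> meaningful at every stage and iterated partial derivatives independent of their order.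
\<close>

definition smooth_fun_on :: "'a::euclidean_space set \<Rightarrow> ('a \<Rightarrow> real) \<Rightarrow> bool" where
  "smooth_fun_on S f \<longleftrightarrow>
     (\<forall>bs. set bs \<subseteq> Basis \<longrightarrow> (\<forall>x\<in>S. iterated_partial_deriv bs f differentiable (at x)))"

type_synonym 'd multi_index = "'d \<Rightarrow> nat"

definition multi_index_abs :: "'d::finite multi_index \<Rightarrow> nat" where
  "multi_index_abs \<alpha> = (\<Sum>i\<in>UNIV. \<alpha> i)"

text \<open>
  The index type carries no order, so an arbitrary enumeration of the coordinates is fixed; for smooth
  functions the choice is irrelevant.
\<close>

definition coords :: "'d::finite list" where
  "coords = (SOME is. distinct is \<and> set is = UNIV)"

definition multi_index_list :: "'d::finite multi_index \<Rightarrow> 'd list" where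
  "multi_index_list \<alpha> = concat (map (\<lambda>i. replicate (\<alpha> i) i) coords)"

text \<open>The derivative of \<open>K (x, z)\<close> of order \<open>\<alpha>\<close> in \<open>x\<close> and of order \<open>\<beta>\<close> in \<open>z\<close>.\<close>

definition mixed_partial_deriv ::
  "'d::finite multi_index \<Rightarrow> 'd multi_index \<Rightarrow> ((real^'d) \<times> (real^'d) \<Rightarrow> real)
     \<Rightarrow> (real^'d) \<times> (real^'d) \<Rightarrow> real" where
  "mixed_partial_deriv \<alpha> \<beta> K =
     iterated_partial_deriv
       (map (\<lambda>i. (axis i 1, 0)) (multi_index_list \<alpha>) @ map (\<lambda>i. (0, axis i 1)) (multi_index_list \<beta>)) K"

text \<open>
  Existence of all the derivatives off the diagonal is part of the notion. Kernels are total functions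
  here; for open \<open>D\<close> only their values on \<open>D \<times> D\<close> matter.
\<close>

definition asymptotically_smooth ::
  "(real^'d::finite) set \<Rightarrow> ((real^'d) \<times> (real^'d) \<Rightarrow> real) \<Rightarrow> bool" where
  "asymptotically_smooth D K \<longleftrightarrow>
     smooth_fun_on {(x, z). x \<in> D \<and> z \<in> D \<and> x \<noteq> z} K \<and>
     (\<exists>C>0. \<exists>r>0. \<forall>\<alpha> \<beta>. \<forall>x\<in>D. \<forall>z\<in>D. x \<noteq> z \<longrightarrow>
        \<bar>mixed_partial_deriv \<alpha> \<beta> K (x, z)\<bar>
          \<le> C * (fact (multi_index_abs \<alpha> + multi_index_abs \<beta>)
                 / (r ^ (multi_index_abs \<alpha> + multi_index_abs \<beta>)
                    * norm (x - z) ^ (multi_index_abs \<alpha> + multi_index_abs \<beta>))))"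

text \<open>On the diagonal the even case evaluates to \<open>0\<close>, the continuous extension.\<close>

definition polyharmonic_spline :: "nat \<Rightarrow> (real^'d::finite) \<times> (real^'d) \<Rightarrow> real" where
  "polyharmonic_spline l = (\<lambda>(x, y).
     if odd l then norm (x - y) ^ l else norm (x - y) ^ l * ln (norm (x - y)))"

definition multiquadric :: "real \<Rightarrow> real \<Rightarrow> (real^'d::finite) \<times> (real^'d) \<Rightarrow> real" where
  "multiquadric c \<beta> = (\<lambda>(x, y). (- 1) ^ nat \<lceil>\<beta>\<rceil> * (c\<^sup>2 + (norm (x - y))\<^sup>2) powr \<beta>)"

end

theory Submission
  imports Defs
begin

text \<open>
  All kernels in question are radial: off the diagonal \<open>K (x, z) = \<phi> 0 (w \<bullet> w)\<close> with \<open>w = x - z\<close>,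
  where \<open>\<phi> 0\<close> is the head of a chain \<open>\<phi> (k + 1) = (\<phi> k)'\<close> on \<open>(0, \<infinity>)\<close> that satisfies the
  one-variable estimate \<open>\<bar>\<phi> k s\<bar> \<le> M * A ^ k * k! / s ^ k\<close> on bounded intervals \<open>(0, S]\<close>.
  Asymptotic smoothness follows from this estimate alone, by counting terms. A directional
  derivative replaces a product of linear forms \<open>w \<bullet> u\<close> times \<open>\<phi> k (w \<bullet> w)\<close> by one product for each
  factor, in which that factor has become a constant, and one product with an additional linear
  factor and \<open>\<phi> (k + 1)\<close>. After \<open>n\<close> derivatives every product has at most \<open>n\<close> factors, and
  \<open>2 * k\<close> minus the number of factors is \<open>n\<close>, so that it is bounded by a constant times
  \<open>norm w powr - n\<close>. If a product with coefficient \<open>c\<close> is given the weight \<open>\<bar>c\<bar> * A ^ k * k!\<close>, the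
  total weight grows in the \<open>n\<close>-th step by at most the factor \<open>(1 + 2 * A) * (n + 1)\<close>: at most \<open>n\<close>
  factors can be differentiated, and the passage to \<open>\<phi> (k + 1)\<close> costs \<open>2 * A * (k + 1)\<close>
  with \<open>k \<le> n\<close>. The weight is therefore at most \<open>(1 + 2 * A) ^ n * n!\<close>, which is the required bound.
  The lemmas \<open>radial_sum_deriv\<close> and \<open>radial_sum_bound\<close> make this precise.

  Both families of kernels come from \<open>\<phi> 0 s = (t + s) powr a * (p * ln (t + s) + q)\<close> with
  \<open>a > 0\<close> and \<open>t \<ge> 0\<close>. This form is stable under differentiation, and the one-variable estimate
  holds since the coefficients grow by at most the factor \<open>\<bar>a\<bar> + k + 1\<close> in each step, while
  \<open>y powr a * (\<bar>ln y\<bar> + 1)\<close> stays bounded on bounded intervals because \<open>a > 0\<close>.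
\<close>

section \<open>Derivatives of radial functions\<close>

text \<open>
  \<open>radial_sum \<phi> A n J W f\<close> expresses that \<open>f\<close> is a finite sum of products
  \<open>c * (w \<bullet> u\<^sub>1) * \<dots> * (w \<bullet> u\<^sub>j) * \<phi> k (w \<bullet> w)\<close> with \<open>norm u\<^sub>i \<le> 1\<close>, \<open>j \<le> J\<close>, \<open>2 * k - j = n\<close>, and that
  the weights \<open>\<bar>c\<bar> * A ^ k * k!\<close> add up to at most \<open>W\<close>. The number \<open>n\<close> is the order of the
  singularity at \<open>0\<close> that the estimate for \<open>\<phi>\<close> permits. Products are built one factor at a time,
  so that the product rule for several factors becomes an induction over the rules below.
\<close>

inductive radial_sum ::
  "(nat \<Rightarrow> real \<Rightarrow> real) \<Rightarrow> real \<Rightarrow> nat \<Rightarrow> nat \<Rightarrow> real \<Rightarrow> ('a::euclidean_space \<Rightarrow> real) \<Rightarrow> bool"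
  for \<phi> A where
  radial: "radial_sum \<phi> A (2 * k) 0 (A ^ k * fact k) (\<lambda>w. \<phi> k (w \<bullet> w))"
| linear: "radial_sum \<phi> A (Suc n) J W f \<Longrightarrow> norm u \<le> 1 \<Longrightarrow>
    radial_sum \<phi> A n (Suc J) W (\<lambda>w. (w \<bullet> u) * f w)"
| scale: "radial_sum \<phi> A n J W f \<Longrightarrow> radial_sum \<phi> A n J (\<bar>c\<bar> * W) (\<lambda>w. c * f w)"
| add: "radial_sum \<phi> A n J V f \<Longrightarrow> radial_sum \<phi> A n J W g \<Longrightarrow>
    radial_sum \<phi> A n J (V + W) (\<lambda>w. f w + g w)"
| weaken: "radial_sum \<phi> A n J V f \<Longrightarrow> J \<le> J' \<Longrightarrow> V \<le> W \<Longrightarrow> radial_sum \<phi> A n J' W f"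

lemma radial_sum_weight_nonneg:
  "radial_sum \<phi> A n J W f \<Longrightarrow> A \<ge> 0 \<Longrightarrow> W \<ge> 0"
  by (induction rule: radial_sum.induct) auto

lemma radial_sum_bound:
  assumes "radial_sum \<phi> A n J W f"
    and \<phi>: "\<And>k s. 0 < s \<Longrightarrow> s \<le> S \<Longrightarrow> \<bar>\<phi> k s\<bar> \<le> M * (A ^ k * fact k) / s ^ k"
    and "M \<ge> 0" "w \<noteq> 0" "(norm w)\<^sup>2 \<le> S"
  shows "\<bar>f w\<bar> \<le> M * W / norm w ^ n"
  using assms(1)
proof (induction rule: radial_sum.induct)
  case (radial k)
  show ?case
    using \<phi>[of "w \<bullet> w" k] assms(4,5)
    by (simp add: power2_norm_eq_inner[symmetric] power_mult)
next
  case (linear n J W f u)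
  have "\<bar>w \<bullet> u\<bar> \<le> norm w * norm u"
    by (rule Cauchy_Schwarz_ineq2)
  also have "\<dots> \<le> norm w"
    using linear.hyps(2) by (simp add: mult_left_le)
  finally have "\<bar>(w \<bullet> u) * f w\<bar> \<le> norm w * (M * W / norm w ^ Suc n)"
    unfolding abs_mult using linear.IH by (intro mult_mono) auto
  also have "\<dots> = M * W / norm w ^ n"
    using \<open>w \<noteq> 0\<close> by simp
  finally show ?case .
next
  case (scale n J W f c)
  have "\<bar>c * f w\<bar> \<le> \<bar>c\<bar> * (M * W / norm w ^ n)"
    unfolding abs_mult using scale.IH by (intro mult_left_mono) auto
  then show ?case by (simp add: mult_ac)
next
  case (add n J V f W g)
  have "\<bar>f w + g w\<bar> \<le> M * V / norm w ^ n + M * W / norm w ^ n"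
    using add.IH by linarith
  then show ?case by (simp add: distrib_left add_divide_distrib)
next
  case (weaken n J V f J' W)
  have "M * V / norm w ^ n \<le> M * W / norm w ^ n"
    using weaken.hyps \<open>M \<ge> 0\<close> by (intro divide_right_mono mult_left_mono) auto
  with weaken.IH show ?case by linarith
qed

lemma radial_sum_differentiable:
  assumes "radial_sum \<phi> A n J W f"
    and \<phi>: "\<And>k s. 0 < s \<Longrightarrow> (\<phi> k has_real_derivative \<phi> (Suc k) s) (at s)"
    and "w \<noteq> 0"
  shows "f differentiable (at w)"
  using assms(1)
proof (induction rule: radial_sum.induct)
  case (radial k)
  have "\<phi> k differentiable (at (w \<bullet> w))"
    using \<phi>[of "w \<bullet> w" k] \<open>w \<noteq> 0\<close> real_differentiable_def by auto
  moreover have "(\<lambda>w. w \<bullet> w) differentiable (at w)"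
    by (intro differentiable_inner differentiable_ident)
  ultimately show ?case
    by (rule differentiable_compose)
next
  case (linear n J W f u)
  then show ?case
    by (intro differentiable_mult differentiable_inner differentiable_ident differentiable_const)
next
  case (scale n J W f c)
  then show ?case by (intro differentiable_mult differentiable_const)
next
  case (add n J V f W g)
  then show ?case by (intro differentiable_add)
qed auto

text \<open>
  The factor \<open>J + A * (n + J + 2)\<close> bounds the growth of the weight: up to \<open>J\<close> linear factors are
  differentiated, and a term with \<open>\<phi> k\<close> has \<open>2 * k \<le> n + J\<close>, so the new factor \<open>2 * (w \<bullet> v)\<close>
  together with the passage from \<open>A ^ k * k!\<close> to \<open>A ^ (k + 1) * (k + 1)!\<close> contributes at most
  \<open>A * (n + J + 2)\<close>.
\<close>

lemma radial_sum_deriv: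
  assumes "radial_sum \<phi> A n J W f"
    and \<phi>: "\<And>k s. 0 < s \<Longrightarrow> (\<phi> k has_real_derivative \<phi> (Suc k) s) (at s)"
    and "A \<ge> 0" "norm v \<le> 1"
  shows "\<exists>g. radial_sum \<phi> A (Suc n) (Suc J) ((J + A * (real n + real J + 2)) * W) g \<and>
    (\<forall>w. w \<noteq> 0 \<longrightarrow> ((\<lambda>t. f (w + t *\<^sub>R v)) has_real_derivative g w) (at 0))"
  using assms(1)
proof (induction rule: radial_sum.induct)
  case (radial k)
  let ?g = "\<lambda>w. 2 * ((w \<bullet> v) * \<phi> (Suc k) (w \<bullet> w))"
  have "radial_sum \<phi> A (Suc (Suc (2 * k))) 0 (A ^ Suc k * fact (Suc k)) (\<lambda>w. \<phi> (Suc k) (w \<bullet> w))"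
    using radial_sum.radial[of \<phi> A "Suc k"] by simp
  from radial_sum.scale[OF radial_sum.linear[OF this \<open>norm v \<le> 1\<close>], of 2]
  have "radial_sum \<phi> A (Suc (2 * k)) (Suc 0)
      ((real 0 + A * (real (2 * k) + real 0 + 2)) * (A ^ k * fact k)) ?g"
    by (rule radial_sum.weaken) (auto simp: algebra_simps)
  moreover have "((\<lambda>t. \<phi> k ((w + t *\<^sub>R v) \<bullet> (w + t *\<^sub>R v))) has_real_derivative ?g w) (at 0)"
    if "w \<noteq> 0" for w
  proof -
    have sq: "((\<lambda>t. (w + t *\<^sub>R v) \<bullet> (w + t *\<^sub>R v)) has_real_derivative 2 * (w \<bullet> v)) (at 0)"
      unfolding inner_add_left inner_add_right inner_scaleR_left inner_scaleR_right
      by (auto intro!: derivative_eq_intros simp: inner_commute)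
    have "(\<phi> k has_real_derivative \<phi> (Suc k) (w \<bullet> w))
        (at ((w + 0 *\<^sub>R v) \<bullet> (w + 0 *\<^sub>R v)))"
      using \<phi>[of "w \<bullet> w" k] that by simp
    from DERIV_chain2[OF this sq] show ?thesis
      by (simp only: mult_ac)
  qed
  ultimately show ?case by (intro exI[of _ ?g] conjI allI impI)
next
  case (linear n J W f u)
  from linear.IH obtain g where
    g: "radial_sum \<phi> A (Suc (Suc n)) (Suc J) ((J + A * (real (Suc n) + real J + 2)) * W) g" and
    g': "\<forall>w. w \<noteq> 0 \<longrightarrow> ((\<lambda>t. f (w + t *\<^sub>R v)) has_real_derivative g w) (at 0)"
    by (elim exE conjE) (rule that)
  let ?h = "\<lambda>w. (v \<bullet> u) * f w + (w \<bullet> u) * g w"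
  have W: "W \<ge> 0"
    using linear.hyps(1) \<open>A \<ge> 0\<close> by (rule radial_sum_weight_nonneg)
  have "\<bar>v \<bullet> u\<bar> \<le> norm v * norm u"
    by (rule Cauchy_Schwarz_ineq2)
  also have "\<dots> \<le> 1"
    using \<open>norm v \<le> 1\<close> \<open>norm u \<le> 1\<close> by (simp add: mult_le_one)
  finally have "\<bar>v \<bullet> u\<bar> * W \<le> W"
    using W by (simp add: mult_left_le_one_le)
  then have "radial_sum \<phi> A (Suc n) (Suc (Suc J)) W (\<lambda>w. (v \<bullet> u) * f w)"
    using radial_sum.scale[OF linear.hyps(1), of "v \<bullet> u"] by (rule radial_sum.weaken[rotated 2]) auto
  from radial_sum.add[OF this radial_sum.linear[OF g \<open>norm u \<le> 1\<close>]]
  have "radial_sum \<phi> A (Suc n) (Suc (Suc J)) ((Suc J + A * (real n + real (Suc J) + 2)) * W) ?h"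
    by (rule radial_sum.weaken) (auto simp: algebra_simps)
  moreover have "((\<lambda>t. ((w + t *\<^sub>R v) \<bullet> u) * f (w + t *\<^sub>R v)) has_real_derivative ?h w) (at 0)"
    if "w \<noteq> 0" for w
    unfolding inner_add_left inner_scaleR_left
    by (rule derivative_eq_intros g'[rule_format, OF that] refl | simp)+
  ultimately show ?case by (intro exI[of _ ?h] conjI allI impI)
next
  case (scale n J W f c)
  from scale.IH obtain g where
    g: "radial_sum \<phi> A (Suc n) (Suc J) ((J + A * (real n + real J + 2)) * W) g" and
    g': "\<forall>w. w \<noteq> 0 \<longrightarrow> ((\<lambda>t. f (w + t *\<^sub>R v)) has_real_derivative g w) (at 0)"
    by (elim exE conjE) (rule that)
  show ?case
    using radial_sum.scale[OF g, of c] g'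
    by (intro exI[of _ "\<lambda>w. c * g w"]) (auto simp: mult_ac intro: DERIV_cmult)
next
  case (add n J V f W g)
  from add.IH obtain f' g' where
    f: "radial_sum \<phi> A (Suc n) (Suc J) ((J + A * (real n + real J + 2)) * V) f'" and
    f': "\<forall>w. w \<noteq> 0 \<longrightarrow> ((\<lambda>t. f (w + t *\<^sub>R v)) has_real_derivative f' w) (at 0)" and
    g: "radial_sum \<phi> A (Suc n) (Suc J) ((J + A * (real n + real J + 2)) * W) g'" and
    g': "\<forall>w. w \<noteq> 0 \<longrightarrow> ((\<lambda>t. g (w + t *\<^sub>R v)) has_real_derivative g' w) (at 0)"
    by (elim exE conjE) (rule that)
  show ?case
    using radial_sum.add[OF f g] f' g'
    by (intro exI[of _ "\<lambda>w. f' w + g' w"]) (auto simp: distrib_left intro: DERIV_add)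
next
  case (weaken n J V f J' W)
  from weaken.IH obtain g where
    g: "radial_sum \<phi> A (Suc n) (Suc J) ((J + A * (real n + real J + 2)) * V) g" and
    g': "\<forall>w. w \<noteq> 0 \<longrightarrow> ((\<lambda>t. f (w + t *\<^sub>R v)) has_real_derivative g w) (at 0)"
    by (elim exE conjE) (rule that)
  have "V \<ge> 0"
    using weaken.hyps(1) \<open>A \<ge> 0\<close> by (rule radial_sum_weight_nonneg)
  then have "(J + A * (real n + real J + 2)) * V \<le> (J' + A * (real n + real J' + 2)) * W"
    using weaken.hyps \<open>A \<ge> 0\<close> by (intro mult_mono add_mono) auto
  then have "radial_sum \<phi> A (Suc n) (Suc J') ((J' + A * (real n + real J' + 2)) * W) g"
    using weaken.hyps by (intro radial_sum.weaken[OF g]) auto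
  with g' show ?case by (intro exI[of _ g] conjI)
qed

section \<open>Iterated partial derivatives of radial kernels\<close>

lemma norm_fst_minus_snd_Basis:
  "b \<in> Basis \<Longrightarrow> norm (fst b - snd b) = 1"
  by (auto simp: Basis_prod_def)

lemma open_off_diagonal: "open {p :: 'a::real_normed_vector \<times> 'a. fst p \<noteq> snd p}"
  by (intro open_Collect_neq continuous_intros)

text \<open>
  A coordinate direction of \<open>(x, z)\<close> moves \<open>x - z\<close> in a direction of norm \<open>1\<close>, so each partial
  derivative in \<open>x\<close> or \<open>z\<close> is one directional derivative in \<open>x - z\<close>. Starting with order and factor bound
  \<open>0\<close>, both equal \<open>n\<close> after \<open>n\<close> derivatives, and the growth factor of the weight is then
  \<open>n + A * (2 * n + 2) \<le> (1 + 2 * A) * (n + 1)\<close>.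
\<close>

lemma iterated_partial_deriv_radial:
  fixes K :: "'a::euclidean_space \<times> 'a \<Rightarrow> real"
  assumes \<phi>: "\<And>k s. 0 < s \<Longrightarrow> (\<phi> k has_real_derivative \<phi> (Suc k) s) (at s)"
    and "A \<ge> 0"
    and K: "\<And>x z. x \<noteq> z \<Longrightarrow> K (x, z) = \<phi> 0 ((x - z) \<bullet> (x - z))"
    and "set bs \<subseteq> Basis"
  shows "\<exists>g. radial_sum \<phi> A (length bs) (length bs) ((1 + 2 * A) ^ length bs * fact (length bs)) g \<and>
    (\<forall>p. fst p \<noteq> snd p \<longrightarrow> iterated_partial_deriv bs K p = g (fst p - snd p))"
  using \<open>set bs \<subseteq> Basis\<close>
proof (induction bs)
  case Nil
  show ?case
    using radial_sum.radial[of \<phi> A 0] K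
    by (intro exI[of _ "\<lambda>w. \<phi> 0 (w \<bullet> w)"]) (auto simp: iterated_partial_deriv_def)
next
  case (Cons b bs)
  let ?n = "length bs"
  let ?v = "fst b - snd b"
  let ?F = "iterated_partial_deriv bs K"
  obtain g where
    g: "radial_sum \<phi> A ?n ?n ((1 + 2 * A) ^ ?n * fact ?n) g" and
    F: "\<And>p. fst p \<noteq> snd p \<Longrightarrow> ?F p = g (fst p - snd p)"
    using Cons by auto
  have "norm ?v \<le> 1"
    using Cons.prems by (simp add: norm_fst_minus_snd_Basis)
  then have "\<exists>h. radial_sum \<phi> A (Suc ?n) (Suc ?n)
        ((?n + A * (real ?n + real ?n + 2)) * ((1 + 2 * A) ^ ?n * fact ?n)) h \<and>
      (\<forall>w. w \<noteq> 0 \<longrightarrow> ((\<lambda>t. g (w + t *\<^sub>R ?v)) has_real_derivative h w) (at 0))"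
    by (intro radial_sum_deriv[OF g] \<phi> \<open>A \<ge> 0\<close>)
  then obtain h where
    h: "radial_sum \<phi> A (Suc ?n) (Suc ?n)
          ((?n + A * (real ?n + real ?n + 2)) * ((1 + 2 * A) ^ ?n * fact ?n)) h" and
    h': "\<forall>w. w \<noteq> 0 \<longrightarrow> ((\<lambda>t. g (w + t *\<^sub>R ?v)) has_real_derivative h w) (at 0)"
    by (elim exE conjE) (rule that)
  have "(?n + A * (real ?n + real ?n + 2)) * ((1 + 2 * A) ^ ?n * fact ?n)
      \<le> ((1 + 2 * A) * Suc ?n) * ((1 + 2 * A) ^ ?n * fact ?n)"
    using \<open>A \<ge> 0\<close> by (intro mult_right_mono) (auto simp: algebra_simps)
  then have "radial_sum \<phi> A (Suc ?n) (Suc ?n) ((1 + 2 * A) ^ Suc ?n * fact (Suc ?n)) h"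
    by (intro radial_sum.weaken[OF h]) (auto simp: algebra_simps)
  moreover have "iterated_partial_deriv (b # bs) K p = h (fst p - snd p)"
    if p: "fst p \<noteq> snd p" for p
  proof -
    \<comment> \<open>The formula for \<open>?F\<close> holds only off the diagonal, but \<open>p + t *\<^sub>R b\<close> stays off it for small \<open>t\<close>.\<close>
    have "((\<lambda>t. p + t *\<^sub>R b) \<longlongrightarrow> p + 0 *\<^sub>R b) (at 0)"
      by (intro tendsto_intros)
    then have "\<forall>\<^sub>F t in at 0. p + t *\<^sub>R b \<in> {p. fst p \<noteq> snd p}"
      using p by (intro topological_tendstoD[OF _ open_off_diagonal]) auto
    then have "\<forall>\<^sub>F t in nhds 0. p + t *\<^sub>R b \<in> {p. fst p \<noteq> snd p}"
      using p by (auto simp: eventually_nhds_conv_at)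
    then have "\<forall>\<^sub>F t in nhds 0. ?F (p + t *\<^sub>R b) = g ((fst p - snd p) + t *\<^sub>R ?v)"
      by eventually_elim (simp add: F algebra_simps)
    moreover have "((\<lambda>t. g ((fst p - snd p) + t *\<^sub>R ?v)) has_real_derivative h (fst p - snd p)) (at 0)"
      using p by (intro h'[rule_format]) simp
    ultimately have "((\<lambda>t. ?F (p + t *\<^sub>R b)) has_real_derivative h (fst p - snd p)) (at 0)"
      by (subst DERIV_cong_ev[OF refl _ refl])
    then show ?thesis
      by (simp add: iterated_partial_deriv_def partial_deriv_def DERIV_imp_deriv)
  qed
  ultimately show ?case by auto
qed

lemma
  shows set_coords: "set (coords :: 'a::finite list) = UNIV"
    and distinct_coords: "distinct (coords :: 'a list)"
proof -
  have "\<exists>is. distinct is \<and> set is = (UNIV :: 'a set)"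
    using finite_distinct_list[OF finite] by metis
  then have "distinct (coords :: 'a list) \<and> set coords = (UNIV :: 'a set)"
    unfolding coords_def by (rule someI_ex)
  then show "set coords = (UNIV :: 'a set)" "distinct (coords :: 'a list)" by auto
qed

lemma length_multi_index_list: "length (multi_index_list \<alpha>) = multi_index_abs \<alpha>"
proof -
  have "length (multi_index_list \<alpha>) = (\<Sum>i\<leftarrow>coords. \<alpha> i)"
    by (simp add: multi_index_list_def length_concat o_def)
  also have "\<dots> = multi_index_abs \<alpha>"
    by (simp add: multi_index_abs_def sum_list_distinct_conv_sum_set distinct_coords set_coords)
  finally show ?thesis .
qed

text \<open>
  The kernels grow at infinity, so the constant \<open>M\<close> in the one-variable estimate has to depend on the
  interval \<open>(0, S]\<close>. Boundedness of \<open>D\<close> provides one interval that contains \<open>(norm (x - z))\<^sup>2\<close> for all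
  distinct points of \<open>D\<close>. The radius of asymptotic smoothness is \<open>1 / (1 + 2 * A)\<close>.
\<close>

lemma asymptotically_smooth_radial:
  fixes K :: "(real^'d::finite) \<times> (real^'d) \<Rightarrow> real"
  assumes "bounded D"
    and \<phi>: "\<And>k s. 0 < s \<Longrightarrow> (\<phi> k has_real_derivative \<phi> (Suc k) s) (at s)"
    and "A \<ge> 0"
    and bound: "\<And>S. \<exists>M>0. \<forall>k s. 0 < s \<and> s \<le> S \<longrightarrow> \<bar>\<phi> k s\<bar> \<le> M * (A ^ k * fact k) / s ^ k"
    and K: "\<And>x z. x \<noteq> z \<Longrightarrow> K (x, z) = \<phi> 0 ((x - z) \<bullet> (x - z))"
  shows "asymptotically_smooth D K"
  unfolding asymptotically_smooth_def
proof (intro conjI)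
  show "smooth_fun_on {(x, z). x \<in> D \<and> z \<in> D \<and> x \<noteq> z} K"
    unfolding smooth_fun_on_def
  proof (intro allI impI ballI)
    fix bs :: "((real^'d) \<times> (real^'d)) list" and p
    assume bs: "set bs \<subseteq> Basis" and "p \<in> {(x, z). x \<in> D \<and> z \<in> D \<and> x \<noteq> z}"
    then have p: "fst p \<noteq> snd p" by auto
    obtain g where
      g: "radial_sum \<phi> A (length bs) (length bs) ((1 + 2 * A) ^ length bs * fact (length bs)) g" and
      F: "\<And>p. fst p \<noteq> snd p \<Longrightarrow> iterated_partial_deriv bs K p = g (fst p - snd p)"
      using iterated_partial_deriv_radial[OF \<phi> \<open>A \<ge> 0\<close> K bs] by blast
    have "g differentiable (at (fst p - snd p))"
      using p by (intro radial_sum_differentiable[OF g \<phi>]) auto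
    moreover have "(\<lambda>p. fst p - snd p) differentiable (at p)"
      by (intro differentiable_diff bounded_linear_imp_differentiable bounded_linear_fst bounded_linear_snd)
    ultimately have "(\<lambda>p. g (fst p - snd p)) differentiable (at p)"
      by (rule differentiable_compose)
    then obtain g' where "((\<lambda>p. g (fst p - snd p)) has_derivative g') (at p)"
      by (auto simp: differentiable_def)
    then have "(iterated_partial_deriv bs K has_derivative g') (at p)"
      by (rule has_derivative_transform_within_open[OF _ open_off_diagonal]) (use p F in auto)
    then show "iterated_partial_deriv bs K differentiable (at p)"
      by (auto simp: differentiable_def)
  qed
next
  obtain B where B: "\<And>x. x \<in> D \<Longrightarrow> norm x \<le> B"
    using \<open>bounded D\<close> by (auto simp: bounded_iff)
  obtain M where "M > 0" and
    M: "\<And>k s. 0 < s \<Longrightarrow> s \<le> (2 * B)\<^sup>2 \<Longrightarrow> \<bar>\<phi> k s\<bar> \<le> M * (A ^ k * fact k) / s ^ k"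
    using bound by meson
  show "\<exists>C>0. \<exists>r>0. \<forall>\<alpha> \<beta>. \<forall>x\<in>D. \<forall>z\<in>D. x \<noteq> z \<longrightarrow>
        \<bar>mixed_partial_deriv \<alpha> \<beta> K (x, z)\<bar>
          \<le> C * (fact (multi_index_abs \<alpha> + multi_index_abs \<beta>)
                 / (r ^ (multi_index_abs \<alpha> + multi_index_abs \<beta>)
                    * norm (x - z) ^ (multi_index_abs \<alpha> + multi_index_abs \<beta>)))"
  proof (intro exI conjI allI ballI impI)
    fix \<alpha> \<beta> :: "'d multi_index" and x z
    assume x: "x \<in> D" and z: "z \<in> D" and xz: "x \<noteq> z"
    define bs :: "((real^'d) \<times> (real^'d)) list" where
      "bs = map (\<lambda>i. (axis i 1, 0)) (multi_index_list \<alpha>) @ map (\<lambda>i. (0, axis i 1)) (multi_index_list \<beta>)"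
    have len: "length bs = multi_index_abs \<alpha> + multi_index_abs \<beta>"
      by (simp add: bs_def length_multi_index_list)
    have "set bs \<subseteq> Basis"
      by (auto simp: bs_def Basis_prod_def axis_in_Basis_iff)
    then obtain g where
      g: "radial_sum \<phi> A (length bs) (length bs) ((1 + 2 * A) ^ length bs * fact (length bs)) g" and
      F: "\<And>p. fst p \<noteq> snd p \<Longrightarrow> iterated_partial_deriv bs K p = g (fst p - snd p)"
      using iterated_partial_deriv_radial[OF \<phi> \<open>A \<ge> 0\<close> K] by blast
    have "norm (x - z) \<le> 2 * B"
      using norm_triangle_ineq4[of x z] B[OF x] B[OF z] by linarith
    then have "(norm (x - z))\<^sup>2 \<le> (2 * B)\<^sup>2"
      by (intro power_mono) auto
    then have "\<bar>g (x - z)\<bar>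
        \<le> M * ((1 + 2 * A) ^ length bs * fact (length bs)) / norm (x - z) ^ length bs"
      using \<open>M > 0\<close> xz by (intro radial_sum_bound[OF g M]) auto
    then show "\<bar>mixed_partial_deriv \<alpha> \<beta> K (x, z)\<bar>
          \<le> M * (fact (multi_index_abs \<alpha> + multi_index_abs \<beta>)
                 / ((1 / (1 + 2 * A)) ^ (multi_index_abs \<alpha> + multi_index_abs \<beta>)
                    * norm (x - z) ^ (multi_index_abs \<alpha> + multi_index_abs \<beta>)))"
      using F[of "(x, z)"] xz
      by (simp add: mixed_partial_deriv_def bs_def[symmetric] len[symmetric] power_divide mult_ac)
  qed (use \<open>M > 0\<close> \<open>A \<ge> 0\<close> in auto)
qed

section \<open>Powers with a logarithmic factor\<close>

text \<open>
  The coefficients in the \<open>k\<close>-th derivative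
  \<open>y powr (a - k) * (p\<^sub>k * ln y + q\<^sub>k)\<close> of \<open>y powr a * (p * ln y + q)\<close>.
\<close>

fun log_power_coeffs :: "real \<Rightarrow> real \<times> real \<Rightarrow> nat \<Rightarrow> real \<times> real" where
  "log_power_coeffs a pq 0 = pq"
| "log_power_coeffs a pq (Suc k) =
    (let (p, q) = log_power_coeffs a pq k in ((a - k) * p, (a - k) * q + p))"

definition log_power :: "real \<Rightarrow> real \<times> real \<Rightarrow> real \<Rightarrow> nat \<Rightarrow> real \<Rightarrow> real" where
  "log_power a pq t k s =
    (t + s) powr (a - k) * (fst (log_power_coeffs a pq k) * ln (t + s) + snd (log_power_coeffs a pq k))"

lemma log_power_has_derivative:
  assumes "s > 0" "t \<ge> 0"
  shows "(log_power a pq t k has_real_derivative log_power a pq t (Suc k) s) (at s)"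
proof -
  obtain p q where pq: "log_power_coeffs a pq k = (p, q)" by force
  have y: "t + s > 0" using assms by simp
  have deriv: "((\<lambda>s. (t + s) powr (a - k) * (p * ln (t + s) + q)) has_real_derivative
      (a - k) * (t + s) powr (a - k - 1) * (p * ln (t + s) + q)
        + (t + s) powr (a - k) * (p / (t + s))) (at s)"
    using y by (auto intro!: derivative_eq_intros)
  have split: "(t + s) powr (a - k) = (t + s) powr (a - Suc k) * (t + s)"
    using powr_add[of "t + s" "a - Suc k" 1] y by simp
  have pred: "a - real k - 1 = a - real (Suc k)" by simp
  have "Y * y * (p / y) = Y * p" if "y > 0" for Y y :: real
    using that by simp
  from this[OF y]
  have "(a - k) * (t + s) powr (a - k - 1) * (p * ln (t + s) + q)
        + (t + s) powr (a - k) * (p / (t + s))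
      = (t + s) powr (a - Suc k) * ((a - k) * p * ln (t + s) + ((a - k) * q + p))"
    unfolding split pred by (simp only:) (simp add: algebra_simps)
  with deriv have "((\<lambda>s. (t + s) powr (a - k) * (p * ln (t + s) + q)) has_real_derivative
      (t + s) powr (a - Suc k) * ((a - k) * p * ln (t + s) + ((a - k) * q + p))) (at s)"
    by (simp only:)
  then show ?thesis
    unfolding log_power_def[abs_def] by (simp add: pq)
qed

lemma log_power_coeffs_bound:
  "\<bar>fst (log_power_coeffs a pq k)\<bar> + \<bar>snd (log_power_coeffs a pq k)\<bar>
    \<le> (\<bar>a\<bar> + 1) ^ k * fact k * (\<bar>fst pq\<bar> + \<bar>snd pq\<bar>)"
proof (induction k)
  case 0
  show ?case by simp
next
  case (Suc k)
  obtain p q where pq: "log_power_coeffs a pq k = (p, q)" by force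
  have "\<bar>(a - k) * p\<bar> + \<bar>(a - k) * q + p\<bar> \<le> \<bar>a - k\<bar> * \<bar>p\<bar> + (\<bar>a - k\<bar> * \<bar>q\<bar> + \<bar>p\<bar>)"
    by (metis abs_mult abs_triangle_ineq add_left_mono)
  also have "\<dots> \<le> (\<bar>a - k\<bar> + 1) * (\<bar>p\<bar> + \<bar>q\<bar>)"
    by (simp add: algebra_simps)
  also have "\<dots> \<le> ((\<bar>a\<bar> + 1) * Suc k) * ((\<bar>a\<bar> + 1) ^ k * fact k * (\<bar>fst pq\<bar> + \<bar>snd pq\<bar>))"
  proof (intro mult_mono)
    have "\<bar>a - k\<bar> + 1 \<le> \<bar>a\<bar> + k + 1" by linarith
    also have "\<dots> \<le> (\<bar>a\<bar> + 1) * Suc k" by (simp add: algebra_simps)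
    finally show "\<bar>a - k\<bar> + 1 \<le> (\<bar>a\<bar> + 1) * Suc k" .
  qed (use Suc pq in auto)
  finally show ?case by (simp add: pq mult_ac)
qed

text \<open>
  The positive power absorbs the singularity of the logarithm at \<open>0\<close>: for \<open>y < 1\<close> the inequality
  \<open>ln x \<le> x powr a / a\<close> at \<open>x = 1 / y\<close> gives the summand \<open>1 / a\<close>. The second summand is the same
  inequality at \<open>x = y \<ge> 1\<close>.
\<close>

lemma powr_times_abs_ln_le:
  fixes a y Y :: real
  assumes "a > 0" "0 < y" "y \<le> Y"
  shows "y powr a * (\<bar>ln y\<bar> + 1) \<le> 1 / a + Y powr a * (Y powr a / a) + Y powr a"
proof -
  have Y: "y powr a \<le> Y powr a"
    using assms by (intro powr_mono2) auto
  have "y powr a * \<bar>ln y\<bar> \<le> 1 / a + Y powr a * (Y powr a / a)"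
  proof (cases "y \<ge> 1")
    case True
    have "ln y \<le> y powr a / a"
      using True \<open>a > 0\<close> by (rule ln_powr_bound)
    also have "\<dots> \<le> Y powr a / a"
      using Y \<open>a > 0\<close> by (simp add: divide_right_mono)
    finally have "y powr a * \<bar>ln y\<bar> \<le> Y powr a * (Y powr a / a)"
      using True Y by (intro mult_mono) auto
    then show ?thesis using \<open>a > 0\<close> by (simp add: add_increasing)
  next
    case False
    have "ln (1 / y) \<le> (1 / y) powr a / a"
      using False assms by (intro ln_powr_bound) auto
    then have "y powr a * \<bar>ln y\<bar> \<le> y powr a * ((1 / y) powr a / a)"
      using False assms by (intro mult_left_mono) (auto simp: ln_div)
    also have "\<dots> = 1 / a"
      using assms by (simp add: powr_divide)
    finally show ?thesis using \<open>a > 0\<close> by (simp add: add_increasing2)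
  qed
  with Y show ?thesis by (simp add: distrib_left)
qed

lemma log_power_bound:
  assumes "a > 0" "t \<ge> 0"
  shows "\<exists>M>0. \<forall>k s. 0 < s \<and> s \<le> S \<longrightarrow>
    \<bar>log_power a pq t k s\<bar> \<le> M * ((\<bar>a\<bar> + 1) ^ k * fact k) / s ^ k"
proof -
  let ?Y = "t + S"
  define N where "N = 1 / a + ?Y powr a * (?Y powr a / a) + ?Y powr a"
  define c where "c = \<bar>fst pq\<bar> + \<bar>snd pq\<bar>"
  have "N > 0" using \<open>a > 0\<close> by (auto simp: N_def intro!: add_pos_nonneg)
  have "c \<ge> 0" by (simp add: c_def)
  have "\<bar>log_power a pq t k s\<bar> \<le> (N * (c + 1)) * ((\<bar>a\<bar> + 1) ^ k * fact k) / s ^ k"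
    if s: "0 < s" "s \<le> S" for k s
  proof -
    define y where "y = t + s"
    have y: "0 < y" "s \<le> y" "y \<le> ?Y" using s assms by (auto simp: y_def)
    obtain p q where pq: "log_power_coeffs a pq k = (p, q)" by force
    have "\<bar>p * ln y + q\<bar> \<le> \<bar>p\<bar> * \<bar>ln y\<bar> + \<bar>q\<bar>"
      by (metis abs_mult abs_triangle_ineq add_right_mono order_trans order_refl)
    also have "\<dots> \<le> (\<bar>ln y\<bar> + 1) * (\<bar>p\<bar> + \<bar>q\<bar>)"
      by (simp add: algebra_simps)
    also have "\<dots> \<le> (\<bar>ln y\<bar> + 1) * ((\<bar>a\<bar> + 1) ^ k * fact k * (c + 1))"
    proof (intro mult_left_mono)
      have "(\<bar>a\<bar> + 1) ^ k * fact k * c \<le> (\<bar>a\<bar> + 1) ^ k * fact k * (c + 1)"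
        by (intro mult_left_mono) auto
      with log_power_coeffs_bound[of a pq k]
      show "\<bar>p\<bar> + \<bar>q\<bar> \<le> (\<bar>a\<bar> + 1) ^ k * fact k * (c + 1)"
        unfolding pq fst_conv snd_conv c_def by (rule order_trans)
    qed auto
    finally have pq_bound: "\<bar>p * ln y + q\<bar> \<le> (\<bar>ln y\<bar> + 1) * ((\<bar>a\<bar> + 1) ^ k * fact k * (c + 1))" .
    have "\<bar>log_power a pq t k s\<bar> = y powr a / y ^ k * \<bar>p * ln y + q\<bar>"
      using y by (simp add: log_power_def pq y_def[symmetric] abs_mult powr_diff powr_realpow)
    also have "\<dots> \<le> y powr a / y ^ k * ((\<bar>ln y\<bar> + 1) * ((\<bar>a\<bar> + 1) ^ k * fact k * (c + 1)))"
      using y by (intro mult_left_mono[OF pq_bound]) auto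
    also have "\<dots> = (y powr a * (\<bar>ln y\<bar> + 1)) * ((\<bar>a\<bar> + 1) ^ k * fact k * (c + 1)) / y ^ k"
      by simp
    also have "\<dots> \<le> N * ((\<bar>a\<bar> + 1) ^ k * fact k * (c + 1)) / s ^ k"
    proof (intro frac_le mult_right_mono)
      show "y powr a * (\<bar>ln y\<bar> + 1) \<le> N"
        unfolding N_def using \<open>a > 0\<close> y by (intro powr_times_abs_ln_le) auto
      show "s ^ k \<le> y ^ k"
        using y s by (intro power_mono) auto
    qed (use \<open>N > 0\<close> \<open>c \<ge> 0\<close> s in auto)
    finally show ?thesis by (simp add: mult_ac)
  qed
  moreover have "N * (c + 1) > 0" using \<open>N > 0\<close> \<open>c \<ge> 0\<close> by simp
  ultimately show ?thesis by blast
qed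

lemma asymptotically_smooth_log_power:
  fixes K :: "(real^'d::finite) \<times> (real^'d) \<Rightarrow> real"
  assumes "bounded D" "a > 0" "t \<ge> 0"
    and K: "\<And>x z. x \<noteq> z \<Longrightarrow>
      K (x, z) = (t + (norm (x - z))\<^sup>2) powr a * (p * ln (t + (norm (x - z))\<^sup>2) + q)"
  shows "asymptotically_smooth D K"
proof (rule asymptotically_smooth_radial[OF \<open>bounded D\<close>])
  show "(log_power a (p, q) t k has_real_derivative log_power a (p, q) t (Suc k) s) (at s)"
    if "0 < s" for k s
    using that \<open>t \<ge> 0\<close> by (rule log_power_has_derivative)
  show "\<exists>M>0. \<forall>k s. 0 < s \<and> s \<le> S \<longrightarrow>
      \<bar>log_power a (p, q) t k s\<bar> \<le> M * ((\<bar>a\<bar> + 1) ^ k * fact k) / s ^ k" for S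
    using assms by (intro log_power_bound)
qed (simp_all add: K log_power_def power2_norm_eq_inner)

section \<open>Polyharmonic splines and multiquadrics\<close>

lemma asymptotically_smooth_polyharmonic_spline:
  fixes D :: "(real^'d::finite) set"
  assumes "bounded D" "l > 0"
  shows "asymptotically_smooth D (polyharmonic_spline l)"
proof -
  have powr: "(r\<^sup>2) powr (real l / 2) = r ^ l" and ln: "ln (r\<^sup>2) = 2 * ln r" if "r > 0" for r :: real
  proof -
    have "(r\<^sup>2) powr (real l / 2) = (r powr 2) powr (real l / 2)"
      using that by simp
    also have "\<dots> = r ^ l"
      using that by (simp only: powr_powr) (simp add: powr_realpow)
    finally show "(r\<^sup>2) powr (real l / 2) = r ^ l" .
    show "ln (r\<^sup>2) = 2 * ln r"
      using that by (simp add: ln_realpow)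
  qed
  show ?thesis
  proof (rule asymptotically_smooth_log_power[OF \<open>bounded D\<close>, where a = "l / 2" and t = 0
        and p = "if odd l then 0 else 1 / 2" and q = "if odd l then 1 else 0"])
    fix x z :: "real^'d"
    assume "x \<noteq> z"
    then show "polyharmonic_spline l (x, z) = (0 + (norm (x - z))\<^sup>2) powr (real l / 2) *
        ((if odd l then 0 else 1 / 2) * ln (0 + (norm (x - z))\<^sup>2) + (if odd l then 1 else 0))"
      by (simp add: polyharmonic_spline_def powr ln)
  qed (use \<open>l > 0\<close> in auto)
qed

lemma asymptotically_smooth_multiquadric:
  fixes D :: "(real^'d::finite) set"
  assumes "bounded D" "\<beta> > 0"
  shows "asymptotically_smooth D (multiquadric c \<beta>)"
  by (rule asymptotically_smooth_log_power[OF assms, where t = "c\<^sup>2" and p = 0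
        and q = "(- 1) ^ nat \<lceil>\<beta>\<rceil>"]) (simp_all add: multiquadric_def)

theorem corollary3p6:
  fixes D :: "(real^'d::finite) set"
  assumes "bounded D" and "lipschitz_domain D"
  shows "(\<forall>l::nat. l > 0 \<longrightarrow> asymptotically_smooth D (polyharmonic_spline l)) \<and>
         (\<forall>c \<beta>::real. c > 0 \<and> \<beta> > 0 \<and> \<beta> \<notin> \<nat> \<longrightarrow> asymptotically_smooth D (multiquadric c \<beta>))"
  using assms(1) asymptotically_smooth_polyharmonic_spline asymptotically_smooth_multiquadric by blast

end
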